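(* Let $P$ be a set of $n$ points in $\mathbb{R}^2\subset\mathbb{R}\mathcal{P}^2$ in general position, and let $h_k^p(P)$ be the number of projective $k$-holes in $P$. Then $$h_3^p(P)\ge h_3(P)+\frac13\binom n2\qquad\text{and}\qquad h_4^p(P)\ge h_4(P)+\frac12\left(\binom n2-3n+3\right),$$ where $h_k(P)$ is the number of affine $k$-holes in $P$ in the plane $\mathbb{R}^2$.
   Context: A finite point set is in general position if no three of its points lie on a common line. For a finite set $S\subset\mathbb{R}^2$ in general position, an affine $k$-hole in $S$ is a convex polygon with $k$ vertices, all in $S$, containing no point of $S$ in its interior. A Euclidean plane $\rho\subset\mathbb{R}\mathcal{P}^2$ is the set obtained from the real projective plane $\mathbb{R}\mathcal{P}^2$ by removing a projective line. A subset $X\subset\mathbb{R}\mathcal{P}^2$ is semiconvex if any two points of $X$ can be joined by a (projective) line segment contained in $X$; it is convex if it is semiconvex and contained in some Euclidean plane. A projective convex hull of $Y$ is an inclusion-wise minimal convex subset of $\mathbb{R}\mathcal{P}^2$ containing $Y$ (not necessarily unique). For a finite set $P\subset\mathbb{R}\mathcal{P}^2$ in general position, a projective $k$-gon determined by $P$ is a projective convex hull of a set $G$ of $k$ points of $P$ which contains all points of $G$ on its boundary; equivalently, a subset of $\mathbb{R}\mathcal{P}^2$ that is a convex polygon with $k$ vertices, all in $P$, in some Euclidean plane. A projective $k$-hole in $P$ ($k\ge3$) is a projective $k$-gon determined by $P$ with no point of $P$ in its interior. Holes are counted as subsets of $\mathbb{R}\mathcal{P}^2$ (one set of $3$ or $4$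 points may determine several projective holes).
   Formalization: The first inequality is stated for n ≠ 2 and the second for n ≠ 0; in the excluded cases the claim is false as written, since it would read 0 ≥ 1/3 for n = 2 and 0 ≥ 3/2 for n = 0. *)

theory Defs
  imports "HOL-Analysis.Analysis"
begin

(* Points of the real projective plane are the lines through the origin of R^2 x R, so that
   the affine point x has homogeneous coordinates (x, 1). *)
typedef rp2 = "{L :: ((real^2) \<times> real) set. subspace L \<and> dim L = 1}"
proof
  show "span {(0, 1)} \<in> {L :: ((real^2) \<times> real) set. subspace L \<and> dim L = 1}"
    by (auto simp: subspace_span dim_eq_card_independent zero_prod_def)
qed

(* Meaningful for v \<noteq> 0 only. *)
definition rp2_of :: "(real^2) \<times> real \<Rightarrow> rp2" where
  "rp2_of v = Abs_rp2 (span {v})"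

definition affine_embed :: "real^2 \<Rightarrow> rp2" where
  "affine_embed x = rp2_of (x, 1)"

(* The quotient topology with respect to rp2_of on the nonzero vectors; interior and frontier
   of subsets of rp2 below refer to it. *)
instantiation rp2 :: topological_space
begin

definition open_rp2 :: "rp2 set \<Rightarrow> bool" where
  "open_rp2 U \<longleftrightarrow> open {v. v \<noteq> 0 \<and> rp2_of v \<in> U}"

instance
proof
  show "open (UNIV :: rp2 set)"
  proof -
    have "{v :: (real^2) \<times> real. v \<noteq> 0} = - {0}" by auto
    then show ?thesis by (simp add: open_rp2_def open_Compl)
  qed
next
  fix S T :: "rp2 set"
  assume "open S" "open T"
  moreover have "{v. v \<noteq> 0 \<and> rp2_of v \<in> S \<inter> T}
      = {v. v \<noteq> 0 \<and> rp2_of v \<in> S} \<inter> {v. v \<noteq> 0 \<and> rp2_of v \<in> T}" by auto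
  ultimately show "open (S \<inter> T)" by (simp only: open_rp2_def open_Int)
next
  fix K :: "rp2 set set"
  assume "\<forall>S\<in>K. open S"
  moreover have "{v. v \<noteq> 0 \<and> rp2_of v \<in> \<Union>K} = (\<Union>S\<in>K. {v. v \<noteq> 0 \<and> rp2_of v \<in> S})" by auto
  ultimately show "open (\<Union>K)" by (simp only: open_rp2_def) (rule open_UN, simp)
qed

end

definition projective_line :: "rp2 set \<Rightarrow> bool" where
  "projective_line l \<longleftrightarrow> (\<exists>W. subspace W \<and> dim W = 2 \<and> l = {p. Rep_rp2 p \<subseteq> W})"

definition euclidean_plane :: "rp2 set \<Rightarrow> bool" where
  "euclidean_plane \<rho> \<longleftrightarrow> (\<exists>l. projective_line l \<and> \<rho> = UNIV - l)"

(* Two distinct points are joined by exactly two projective segments, according to the relative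
   sign of the chosen representatives; a point is joined to itself by the trivial segment only. *)
definition projective_segment :: "rp2 \<Rightarrow> rp2 \<Rightarrow> rp2 set \<Rightarrow> bool" where
  "projective_segment p q s \<longleftrightarrow>
     (\<exists>u v. 0 \<notin> closed_segment u v \<and> rp2_of u = p \<and> rp2_of v = q \<and> s = rp2_of ` closed_segment u v)"

definition semiconvex :: "rp2 set \<Rightarrow> bool" where
  "semiconvex X \<longleftrightarrow> (\<forall>p\<in>X. \<forall>q\<in>X. \<exists>s. projective_segment p q s \<and> s \<subseteq> X)"

definition projective_convex :: "rp2 set \<Rightarrow> bool" where
  "projective_convex X \<longleftrightarrow> semiconvex X \<and> (\<exists>\<rho>. euclidean_plane \<rho> \<and> X \<subseteq> \<rho>)"

definition projective_convex_hull :: "rp2 set \<Rightarrow> rp2 set \<Rightarrow> bool" where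
  "projective_convex_hull Y X \<longleftrightarrow>
     projective_convex X \<and> Y \<subseteq> X \<and>
     (\<forall>Z. projective_convex Z \<and> Y \<subseteq> Z \<and> Z \<subseteq> X \<longrightarrow> Z = X)"

definition projective_gon :: "nat \<Rightarrow> rp2 set \<Rightarrow> rp2 set \<Rightarrow> bool" where
  "projective_gon k P X \<longleftrightarrow>
     (\<exists>G. G \<subseteq> P \<and> finite G \<and> card G = k \<and> projective_convex_hull G X \<and> G \<subseteq> frontier X)"

definition projective_hole :: "nat \<Rightarrow> rp2 set \<Rightarrow> rp2 set \<Rightarrow> bool" where
  "projective_hole k P X \<longleftrightarrow> projective_gon k P X \<and> interior X \<inter> P = {}"

definition num_projective_holes :: "nat \<Rightarrow> rp2 set \<Rightarrow> nat" where
  "num_projective_holes k P = card {X. projective_hole k P X}"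

definition general_position :: "(real^2) set \<Rightarrow> bool" where
  "general_position S \<longleftrightarrow> (\<forall>T. T \<subseteq> S \<and> card T = 3 \<longrightarrow> \<not> collinear T)"

definition vertices :: "(real^2) set \<Rightarrow> (real^2) set" where
  "vertices X = {v. v extreme_point_of X}"

definition convex_polygon :: "nat \<Rightarrow> (real^2) set \<Rightarrow> bool" where
  "convex_polygon k X \<longleftrightarrow> polytope X \<and> aff_dim X = 2 \<and> card (vertices X) = k"

definition affine_hole :: "nat \<Rightarrow> (real^2) set \<Rightarrow> (real^2) set \<Rightarrow> bool" where
  "affine_hole k S X \<longleftrightarrow> convex_polygon k X \<and> vertices X \<subseteq> S \<and> interior X \<inter> S = {}"

definition num_affine_holes :: "nat \<Rightarrow> (real^2) set \<Rightarrow> nat" where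
  "num_affine_holes k S = card {X. affine_hole k S X}"

end

theory Submission
  imports Defs
begin

text \<open>
  The affine holes of P are projective holes, contained in the affine plane. The bounds come from
  counting the further holes, those that meet the line at infinity, through the segments which join
  two points p and q of P across infinity. In homogeneous coordinates such a segment is spanned by
  the vectors (p, 1) and -(q, 1).

  Suppose that n is at least 3, and fix such an infinite segment. Modulo the plane spanned by its two
  vectors, space is one-dimensional, so every other point z of P has a unique multiple of the form
  A z * (p, 1) - B z * (q, 1) + e for a fixed vector e. This sends the remaining points of P to points
  (A z, B z) of the plane, and it turns emptiness into a statement about the dominance order of that
  plane: z lies in the triangle spanned by the segment and r exactly if (A z, B z) dominates (A r, B r). The
  segment together with a maximal r therefore spans an empty triangle. Each triangle contains three
  pairs of its vertices, so at least a third of the (n choose 2) pairs are counted as triangles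
  (\<open>infinite_triangles\<close>).

  If some r strictly dominates some s, then the segment is a diagonal of the convex quadrilateral
  spanned by p, r, q, s, and replacing r by a maximal point above it and s by a minimal point below it
  empties the quadrilateral. A quadrilateral has two diagonals, so at least half of the pairs which
  admit such r and s are counted (\<open>infinite_quadrilaterals\<close>). They exist exactly if the infinite
  segment is crossed by a segment, finite or infinite, between two other points of P. A point p has at
  most two partners for which this fails: relative to three partners, p has barycentric coordinates
  with sum 1, and a positive coordinate at one of them gives a crossing through the other two
  (\<open>card_uncrossed\<close>). So at most 2 n of the pairs are lost, and 2 n is at most 3 n - 3 for n at
  least 3; for smaller n the second bound follows from the affine holes alone.
\<close>

section \<open>Convex hulls in homogeneous coordinates\<close>

definition hom :: "real^2 \<Rightarrow> (real^2) \<times> real" where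
  "hom x = (x, 1)"

lemma affine_embed_eq: "affine_embed x = rp2_of (hom x)"
  by (simp add: affine_embed_def hom_def)

lemma rp2_of_eq_iff:
  assumes "v \<noteq> 0" "w \<noteq> 0"
  shows "rp2_of v = rp2_of w \<longleftrightarrow> (\<exists>c. c \<noteq> 0 \<and> w = c *\<^sub>R v)"
proof -
  have mem: "span {x} \<in> {L. subspace L \<and> dim L = 1}" if "x \<noteq> 0" for x :: "(real^2) \<times> real"
    using that by (simp add: dim_eq_card_independent)
  have "rp2_of v = rp2_of w \<longleftrightarrow> span {v} = span {w}"
    unfolding rp2_of_def using assms by (intro Abs_rp2_inject mem)
  also have "\<dots> \<longleftrightarrow> (\<exists>c. c \<noteq> 0 \<and> w = c *\<^sub>R v)"
  proof
    assume "span {v} = span {w}"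
    then have "w \<in> span {v}" by (simp add: span_base)
    then show "\<exists>c. c \<noteq> 0 \<and> w = c *\<^sub>R v" using assms by (auto simp: span_singleton)
  next
    assume "\<exists>c. c \<noteq> 0 \<and> w = c *\<^sub>R v"
    then obtain c where c: "c \<noteq> 0" "w = c *\<^sub>R v" by blast
    then show "span {v} = span {w}"
      using span_image_scale[of "{v}" "\<lambda>_. c"] by simp
  qed
  finally show ?thesis .
qed

lemma Rep_rp2_of: "v \<noteq> 0 \<Longrightarrow> Rep_rp2 (rp2_of v) = span {v}"
  unfolding rp2_of_def by (intro Abs_rp2_inverse) (simp add: dim_eq_card_independent)

lemma rp2_of_scale: "v \<noteq> 0 \<Longrightarrow> c \<noteq> 0 \<Longrightarrow> rp2_of (c *\<^sub>R v) = rp2_of v"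
  using rp2_of_eq_iff[of v "c *\<^sub>R v"] by auto

lemma hom_nonzero [simp]: "hom x \<noteq> 0"
  by (simp add: hom_def zero_prod_def)

lemma hom_inject [simp]: "hom x = hom y \<longleftrightarrow> x = y"
  by (simp add: hom_def)

lemma affine_embed_inject [simp]: "affine_embed x = affine_embed y \<longleftrightarrow> x = y"
  by (auto simp: affine_embed_eq rp2_of_eq_iff) (auto simp: hom_def)

text \<open>The vector (x - y, 0) represents the point at infinity of the line through x and y. It lies
  inside the infinite segment between x and y, and serves as its midpoint below.\<close>

lemma ideal_point_not_affine:
  assumes "x \<noteq> y"
  shows "rp2_of (hom x - hom y) \<notin> range affine_embed"
proof
  assume "rp2_of (hom x - hom y) \<in> range affine_embed"
  then obtain z where "rp2_of (hom x - hom y) = rp2_of (hom z)"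
    by (auto simp: affine_embed_eq)
  then show False using assms by (subst (asm) rp2_of_eq_iff) (auto simp: hom_def zero_prod_def)
qed

lemma convex_linear_ge: "linear g \<Longrightarrow> convex {x. 0 \<le> (g x :: real)}"
  by (auto simp: convex_def linear_add linear_scale)

lemma convex_linear_gt: "linear g \<Longrightarrow> convex {x. 0 < (g x :: real)}"
proof (rule convexI)
  fix x y s t assume g: "linear g" and *: "x \<in> {x. 0 < g x}" "y \<in> {x. 0 < g x}" "0 \<le> s" "0 \<le> t" "s + t = (1::real)"
  then have "0 < s * g x + t * g y"
    by (cases "s = 0") (auto intro: add_pos_nonneg)
  then show "s *\<^sub>R x + t *\<^sub>R y \<in> {x. 0 < g x}" using g by (simp add: linear_add linear_scale)
qed

lemma linear_ge_on_hull:
  assumes "linear g" "\<And>a. a \<in> A \<Longrightarrow> 0 \<le> (g a :: real)" "x \<in> convex hull A"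
  shows "0 \<le> g x"
  using hull_minimal[of A "{x. 0 \<le> g x}" convex] convex_linear_ge[of g] assms by auto

lemma linear_gt_on_hull:
  assumes "linear g" "\<And>a. a \<in> A \<Longrightarrow> 0 < (g a :: real)" "x \<in> convex hull A"
  shows "0 < g x"
  using hull_minimal[of A "{x. 0 < g x}" convex] convex_linear_gt[of g] assms by auto

text \<open>The projective convex sets considered below are images of convex hulls of vectors. A choice of
  signs of the vectors over given points of the projective plane selects one of their projective
  convex hulls. The set is meaningful if some linear functional is positive on the vectors, which also
  keeps the origin out of the hull.\<close>

definition proj_hull :: "((real^2) \<times> real) set \<Rightarrow> rp2 set" where
  "proj_hull A = rp2_of ` (convex hull A)"

lemma in_proj_hullD:
  assumes "linear f" "\<And>a. a \<in> A \<Longrightarrow> 0 < (f a :: real)" "rp2_of x \<in> proj_hull A" "x \<noteq> 0"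
  obtains c y where "c \<noteq> 0" "y \<in> convex hull A" "x = c *\<^sub>R y" "f y > 0"
proof -
  obtain y where y: "y \<in> convex hull A" "rp2_of x = rp2_of y"
    using assms by (auto simp: proj_hull_def)
  have fy: "f y > 0" using linear_gt_on_hull[OF assms(1,2) y(1)] .
  then have "y \<noteq> 0" using linear_0[OF assms(1)] by auto
  then obtain c where "c \<noteq> 0" "x = c *\<^sub>R y"
    using rp2_of_eq_iff[of y x] y assms by auto
  then show ?thesis using that y fy by blast
qed

text \<open>Removing a projective line amounts to choosing a linear functional, up to a factor: the line
  consists of the points on which the functional vanishes.\<close>

lemma hyperplane_complement:
  assumes "linear f" "f w \<noteq> (0::real)"
  shows "euclidean_plane (UNIV - {p. Rep_rp2 p \<subseteq> {x. f x = 0}})"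
proof -
  have f: "f x = adjoint f 1 \<bullet> x" for x
    using adjoint_works[OF assms(1), of x 1] by (simp add: inner_commute)
  then have "adjoint f 1 \<noteq> 0" using assms(2) by (metis inner_zero_left)
  then have "dim {x. f x = 0} = 2" by (subst f) (simp add: dim_hyperplane)
  moreover have "subspace {x. f x = 0}"
    using linear_subspace_kernel[OF assms(1)] .
  ultimately show ?thesis unfolding euclidean_plane_def projective_line_def by blast
qed

lemma euclidean_plane_functional:
  assumes "euclidean_plane \<rho>"
  obtains f :: "(real^2) \<times> real \<Rightarrow> real" where "linear f" "\<And>x. x \<noteq> 0 \<Longrightarrow> rp2_of x \<in> \<rho> \<Longrightarrow> f x \<noteq> 0"
proof -
  obtain W where W: "subspace W" "dim W = 2" "\<rho> = UNIV - {p. Rep_rp2 p \<subseteq> W}"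
    using assms by (auto simp: euclidean_plane_def projective_line_def)
  obtain a where a: "a \<noteq> 0" "span W \<subseteq> {x. a \<bullet> x = 0}"
    using lowdim_subset_hyperplane[of W] W by auto
  have "W = {x. a \<bullet> x = 0}"
    using W a span_superset[of W]
    by (intro subspace_dim_equal) (simp_all add: subspace_hyperplane dim_hyperplane)
  then have "a \<bullet> x \<noteq> 0" if "x \<noteq> 0" "rp2_of x \<in> \<rho>" for x
    using that W by (auto simp: Rep_rp2_of span_singleton)
  moreover have "linear (\<lambda>x. a \<bullet> x)" by (simp add: bounded_linear.linear bounded_linear_inner_right)
  ultimately show ?thesis using that by blast
qed

lemma projective_convex_proj_hull:
  assumes "linear f" "\<And>a. a \<in> A \<Longrightarrow> 0 < (f a :: real)" "A \<noteq> {}"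
  shows "projective_convex (proj_hull A)"
proof -
  have pos: "f x > 0" if "x \<in> convex hull A" for x using linear_gt_on_hull[OF assms(1,2) that] .
  have nz: "x \<noteq> 0" if "x \<in> convex hull A" for x
    using linear_0[OF assms(1)] pos[OF that] by auto
  have "semiconvex (proj_hull A)"
    unfolding semiconvex_def
  proof (intro ballI)
    fix p q assume "p \<in> proj_hull A" "q \<in> proj_hull A"
    then obtain x y where xy: "x \<in> convex hull A" "y \<in> convex hull A" "p = rp2_of x" "q = rp2_of y"
      by (auto simp: proj_hull_def)
    have sub: "closed_segment x y \<subseteq> convex hull A"
      using xy by (simp add: closed_segment_subset)
    then have "projective_segment p q (rp2_of ` closed_segment x y)"
      unfolding projective_segment_def using xy nz by blast
    with sub show "\<exists>s. projective_segment p q s \<and> s \<subseteq> proj_hull A"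
      unfolding proj_hull_def by (meson image_mono)
  qed
  moreover obtain a where "a \<in> A" using assms(3) by blast
  then have "euclidean_plane (UNIV - {p. Rep_rp2 p \<subseteq> {x. f x = 0}})"
    using hyperplane_complement[OF assms(1), of a] assms(2)[of a] by simp
  moreover have "proj_hull A \<subseteq> UNIV - {p. Rep_rp2 p \<subseteq> {x. f x = 0}}"
  proof
    fix p assume "p \<in> proj_hull A"
    then obtain x where x: "x \<in> convex hull A" "p = rp2_of x" by (auto simp: proj_hull_def)
    then have "x \<in> Rep_rp2 p" using nz by (simp add: Rep_rp2_of span_base)
    moreover have "f x \<noteq> 0" using pos[OF x(1)] by simp
    ultimately show "p \<in> UNIV - {p. Rep_rp2 p \<subseteq> {x. f x = 0}}" by blast
  qed
  ultimately show ?thesis unfolding projective_convex_def by blast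
qed

text \<open>In the Euclidean plane on which f does not vanish, only one of the two projective segments
  between two points survives. A semiconvex subset of it therefore has a convex cone of
  representatives with f positive, and that cone contains the hull of A.\<close>

lemma proj_hull_subset:
  assumes "linear f" and pos: "\<And>a. a \<in> A \<Longrightarrow> 0 < (f a :: real)"
    and Z: "semiconvex Z" "\<And>x. x \<noteq> 0 \<Longrightarrow> rp2_of x \<in> Z \<Longrightarrow> f x \<noteq> 0" and "rp2_of ` A \<subseteq> Z"
  shows "proj_hull A \<subseteq> Z"
proof -
  note lin = linear_add[OF assms(1)] linear_scale[OF assms(1)]
  let ?C = "{x. f x > 0 \<and> rp2_of x \<in> Z}"
  have nz: "x \<noteq> 0" if "f x > 0" for x
    using linear_0[OF assms(1)] that by auto
  have "convex ?C"
  proof (rule convexI)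
    fix x y s t
    assume x: "x \<in> ?C" and y: "y \<in> ?C" and st: "0 \<le> s" "0 \<le> t" "s + t = (1::real)"
    let ?z = "s *\<^sub>R x + t *\<^sub>R y"
    have fz: "f ?z > 0" using convexD[OF convex_linear_gt[OF assms(1)], of x y s t] x y st by simp
    obtain S where S: "projective_segment (rp2_of x) (rp2_of y) S" "S \<subseteq> Z"
      using Z(1) x y unfolding semiconvex_def by blast
    then obtain u v where uv: "0 \<notin> closed_segment u v" "rp2_of u = rp2_of x" "rp2_of v = rp2_of y"
      "S = rp2_of ` closed_segment u v" unfolding projective_segment_def by blast
    have uv0: "u \<noteq> 0" "v \<noteq> 0" using uv(1) by auto
    obtain c where c: "c \<noteq> 0" "u = c *\<^sub>R x" using rp2_of_eq_iff[of x u] uv nz x uv0 by auto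
    obtain d where d: "d \<noteq> 0" "v = d *\<^sub>R y" using rp2_of_eq_iff[of y v] uv nz y uv0 by auto
    have seg: "f w \<noteq> 0" if "w \<in> closed_segment u v" for w
      using that uv S Z(2)[of w] by (metis imageI subsetD)
    \<comment> \<open>The functional has no zero on the segment, so its two endpoints lie on the same side.\<close>
    have cd: "c * d > 0"
    proof (rule ccontr)
      assume "\<not> c * d > 0"
      then have "f u * f v < 0"
      proof -
        have "c * d < 0" using \<open>\<not> c * d > 0\<close> c d by (simp add: not_less order.order_iff_strict)
        moreover have "f x * f y > 0" using x y by simp
        moreover have "f u * f v = (c * d) * (f x * f y)" using c d by (simp add: lin)
        ultimately show ?thesis by (metis mult_neg_pos)
      qed
      then have ne: "f u - f v \<noteq> 0" and "0 \<le> f u / (f u - f v)" "f u / (f u - f v) \<le> 1"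
        by (auto simp: mult_less_0_iff divide_simps)
      moreover define r where "r = f u / (f u - f v)"
      ultimately have "(1 - r) *\<^sub>R u + r *\<^sub>R v \<in> closed_segment u v"
        by (auto simp: closed_segment_def)
      moreover have "f ((1 - r) *\<^sub>R u + r *\<^sub>R v) = 0"
      proof -
        have "(f u - f v) * f ((1 - r) *\<^sub>R u + r *\<^sub>R v) = 0"
          using ne by (simp only: lin r_def) (simp add: field_simps)
        then show ?thesis using ne by simp
      qed
      ultimately show False using seg by blast
    qed
    \<comment> \<open>The point s x + t y, rescaled by c / M, as a convex combination of u = c x and v = d y.\<close>
    define m where "m = c / d"
    define M where "M = s + t * m"
    have m: "m > 0" "m * d = c" using cd c d by (auto simp: m_def zero_less_divide_iff zero_less_mult_iff)
    have M: "M > 0"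
    proof (cases "t = 0")
      case False
      then have "0 < t * m" using m st by simp
      then show ?thesis using st by (simp add: M_def)
    qed (use st in \<open>simp add: M_def\<close>)
    have r: "0 \<le> t * m / M" "t * m / M \<le> 1" "1 - t * m / M = s / M"
      using st m M by (auto simp: M_def field_simps)
    have "(s / M) *\<^sub>R u + (t * m / M) *\<^sub>R v = (c / M) *\<^sub>R ?z"
      using c d m by (simp add: scaleR_add_right mult.commute mult.left_commute)
    then have "(c / M) *\<^sub>R ?z \<in> closed_segment u v"
      using r unfolding closed_segment_def by (intro CollectI exI[of _ "t * m / M"]) auto
    then have "rp2_of ((c / M) *\<^sub>R ?z) \<in> Z" using uv S by blast
    then have "rp2_of ?z \<in> Z" using rp2_of_scale[of ?z "c / M"] nz[OF fz] c M by simp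
    then show "?z \<in> ?C" using fz by blast
  qed
  moreover have "A \<subseteq> ?C" using assms by auto
  ultimately have "convex hull A \<subseteq> ?C" by (simp add: hull_minimal)
  then show ?thesis by (auto simp: proj_hull_def)
qed

text \<open>Minimality is automatic: a smaller convex set still avoids the zeros of f, so it has to contain
  the hull of A.\<close>

lemma projective_convex_hull_proj_hull:
  assumes "linear f" "\<And>a. a \<in> A \<Longrightarrow> 0 < (f a :: real)" "A \<noteq> {}"
  shows "projective_convex_hull (rp2_of ` A) (proj_hull A)"
  unfolding projective_convex_hull_def
proof (intro conjI allI impI)
  show "rp2_of ` A \<subseteq> proj_hull A" by (auto simp: proj_hull_def hull_inc)
  fix Z assume Z: "projective_convex Z \<and> rp2_of ` A \<subseteq> Z \<and> Z \<subseteq> proj_hull A"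
  have "f x \<noteq> 0" if "x \<noteq> 0" "rp2_of x \<in> Z" for x
  proof -
    have "rp2_of x \<in> proj_hull A" using that Z by blast
    then obtain c y where "c \<noteq> 0" "x = c *\<^sub>R y" "f y > 0"
      using in_proj_hullD[OF assms(1,2), where x=x] \<open>x \<noteq> 0\<close> by blast
    then show ?thesis by (simp add: linear_scale[OF assms(1)])
  qed
  then have "proj_hull A \<subseteq> Z"
    using proj_hull_subset[OF assms(1,2), where Z=Z] Z by (auto simp: projective_convex_def)
  with Z show "Z = proj_hull A" by blast
qed (rule projective_convex_proj_hull[OF assms])

text \<open>Conversely, a projective convex hull lies in some Euclidean plane, whose functional dictates the
  signs. Only finitely many sign patterns exist, so there are only finitely many holes; this matters
  because the cardinality of an infinite set would be 0.\<close>

lemma projective_convex_hull_eq_proj_hull: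
  assumes "projective_convex_hull (affine_embed ` G) X" "G \<noteq> {}"
  obtains A where "A \<subseteq> hom ` G \<union> uminus ` hom ` G" "X = proj_hull A"
proof -
  obtain \<rho> where \<rho>: "euclidean_plane \<rho>" "X \<subseteq> \<rho>"
    using assms(1) unfolding projective_convex_hull_def projective_convex_def by blast
  obtain f :: "(real^2) \<times> real \<Rightarrow> real"
    where f: "linear f" "\<And>x. x \<noteq> 0 \<Longrightarrow> rp2_of x \<in> \<rho> \<Longrightarrow> f x \<noteq> 0"
    using euclidean_plane_functional[OF \<rho>(1)] by blast
  define A where "A = (\<lambda>x. if f (hom x) > 0 then hom x else - hom x) ` G"
  have GX: "affine_embed ` G \<subseteq> X" using assms(1) unfolding projective_convex_hull_def by blast
  have pos: "0 < f a" if a: "a \<in> A" for a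
  proof -
    obtain x where x: "x \<in> G" "a = (if f (hom x) > 0 then hom x else - hom x)"
      using a unfolding A_def by blast
    have "f (hom x) \<noteq> 0" using GX \<rho> f(2)[of "hom x"] x by (auto simp: affine_embed_eq)
    then show ?thesis using x by (auto simp: linear_neg[OF f(1)])
  qed
  have neg: "rp2_of (- hom x) = rp2_of (hom x)" for x using rp2_of_scale[of "hom x" "-1"] by simp
  have im: "rp2_of ` A = affine_embed ` G"
    unfolding A_def image_image by (intro image_cong) (auto simp: affine_embed_eq neg)
  have "A \<noteq> {}" using assms(2) A_def by auto
  have "proj_hull A \<subseteq> X"
  proof (rule proj_hull_subset[OF f(1) pos])
    show "semiconvex X"
      using assms(1) unfolding projective_convex_hull_def projective_convex_def by blast
    show "f x \<noteq> 0" if "x \<noteq> 0" "rp2_of x \<in> X" for x using f(2) that \<rho> by blast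
  qed (use GX im in auto)
  moreover have "projective_convex (proj_hull A)" "affine_embed ` G \<subseteq> proj_hull A"
    using projective_convex_hull_proj_hull[OF f(1) pos \<open>A \<noteq> {}\<close>] im
    by (auto simp: projective_convex_hull_def)
  ultimately have "X = proj_hull A"
    using assms(1) by (auto simp: projective_convex_hull_def)
  moreover have "A \<subseteq> hom ` G \<union> uminus ` hom ` G" by (auto simp: A_def)
  ultimately show ?thesis using that by blast
qed

lemma finite_projective_holes:
  assumes "finite P" "k > 0"
  shows "finite {X. projective_hole k (affine_embed ` P) X}"
proof (rule finite_subset)
  show "{X. projective_hole k (affine_embed ` P) X} \<subseteq> proj_hull ` Pow (hom ` P \<union> uminus ` hom ` P)"
  proof
    fix X assume "X \<in> {X. projective_hole k (affine_embed ` P) X}"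
    then obtain G where "G \<subseteq> affine_embed ` P" "card G = k" "projective_convex_hull G X"
      by (auto simp: projective_hole_def projective_gon_def)
    moreover from this(1) obtain H where H: "H \<subseteq> P" "G = affine_embed ` H" by (auto simp: subset_image_iff)
    ultimately have "projective_convex_hull (affine_embed ` H) X" "H \<noteq> {}" using assms by auto
    from projective_convex_hull_eq_proj_hull[OF this] obtain A
      where "A \<subseteq> hom ` H \<union> uminus ` hom ` H" "X = proj_hull A" .
    with H show "X \<in> proj_hull ` Pow (hom ` P \<union> uminus ` hom ` P)" by blast
  qed
qed (use assms in auto)

lemma open_preimage: "open U \<Longrightarrow> open {v. v \<noteq> 0 \<and> rp2_of v \<in> U}"
  by (simp add: open_rp2_def)

text \<open>A supporting functional g that vanishes at x takes both signs near x. But f keeps its sign there,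
  and this determines the sign of g on all vectors near x that represent points of the hull.\<close>

lemma not_in_interior_proj_hull:
  assumes "linear f" "\<And>a. a \<in> A \<Longrightarrow> 0 < (f a :: real)"
    and g: "linear g" "\<And>a. a \<in> A \<Longrightarrow> 0 \<le> (g a :: real)" "g w > 0" and x: "x \<noteq> 0" "g x = 0"
  shows "rp2_of x \<notin> interior (proj_hull A)"
proof
  assume int: "rp2_of x \<in> interior (proj_hull A)"
  note lf = linear_add[OF assms(1)] linear_scale[OF assms(1)]
  note lg = linear_add[OF g(1)] linear_scale[OF g(1)]
  have "f x \<noteq> 0"
  proof -
    have "rp2_of x \<in> proj_hull A" using int interior_subset by blast
    then obtain c y where "c \<noteq> 0" "x = c *\<^sub>R y" "f y > 0"
      using in_proj_hullD[OF assms(1,2), where x=x] x(1) by blast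
    then show ?thesis by (simp add: lf)
  qed
  define T where "T = {v. v \<noteq> 0 \<and> rp2_of v \<in> interior (proj_hull A)} \<inter> {v. 0 < f x * f v}"
  have "open {v. 0 < f x * f v}"
    by (intro open_Collect_less continuous_intros linear_continuous_on linear_conv_bounded_linear[THEN iffD1] assms)
  then have "open T" unfolding T_def by (intro open_Int open_preimage) auto
  moreover have "x \<in> T" using int x \<open>f x \<noteq> 0\<close> by (auto simp: T_def zero_less_mult_iff linorder_neq_iff)
  ultimately obtain e where e: "e > 0" "ball x e \<subseteq> T" by (auto simp: open_contains_ball)
  have "w \<noteq> 0" using g(3) linear_0[OF g(1)] by auto
  \<comment> \<open>The step t is small enough to remain in T; its sign makes g negative on the representative with f positive.\<close>
  define t where "t = - sgn (f x) * (e / (2 * norm w))"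
  have "norm (t *\<^sub>R w) < e" using e \<open>w \<noteq> 0\<close> \<open>f x \<noteq> 0\<close> by (simp add: t_def abs_mult abs_sgn_eq)
  then have "x + t *\<^sub>R w \<in> T" by (intro subsetD[OF e(2)]) (simp add: dist_norm)
  then have y: "x + t *\<^sub>R w \<noteq> 0" "rp2_of (x + t *\<^sub>R w) \<in> proj_hull A" "0 < f x * f (x + t *\<^sub>R w)"
    using interior_subset by (auto simp: T_def)
  from in_proj_hullD[OF assms(1,2) y(2,1)] obtain c y
    where c: "c \<noteq> 0" "y \<in> convex hull A" "x + t *\<^sub>R w = c *\<^sub>R y" "f y > 0" .
  have "0 < (f x * c) * f y" using y(3) c(3) by (simp add: lf mult.assoc)
  then have "0 < f x * c" using c(4) by (rule zero_less_mult_pos2)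
  have "0 \<le> g y" using linear_ge_on_hull[OF g(1,2) c(2)] .
  have "g (x + t *\<^sub>R w) = t * g w" using x by (simp add: lg)
  then have "t * g w = c * g y" using c by (simp add: lg)
  then have "(f x * t) * g w = (f x * c) * g y" by simp
  also have "\<dots> \<ge> 0" using \<open>0 < f x * c\<close> \<open>0 \<le> g y\<close> by simp
  finally have "0 \<le> (f x * t) * g w" .
  moreover have "f x * t = - \<bar>f x\<bar> * (e / (2 * norm w))"
    by (simp add: t_def abs_sgn mult.assoc)
  then have "f x * t < 0" using e(1) \<open>w \<noteq> 0\<close> \<open>f x \<noteq> 0\<close> by simp
  then have "(f x * t) * g w < 0" using g(3) by (rule mult_neg_pos)
  ultimately show False by simp
qed

text \<open>Supporting functionals put the vertices on the frontier. If the hull contains no point of P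
  except for the vertices, then this already makes it a hole, and its vertices can be recovered from
  it.\<close>

lemma projective_hole_proj_hull:
  assumes f: "linear f" "\<And>a. a \<in> A \<Longrightarrow> 0 < (f a :: real)"
    and G: "finite G" "G \<subseteq> P" "G \<noteq> {}" "rp2_of ` A = affine_embed ` G"
    and g: "\<And>a. a \<in> A \<Longrightarrow> \<exists>g w. linear g \<and> (\<forall>b\<in>A. 0 \<le> (g b :: real)) \<and> g w > 0 \<and> g a = 0"
    and empty: "\<And>z. z \<in> P \<Longrightarrow> affine_embed z \<in> proj_hull A \<Longrightarrow> z \<in> G"
  shows "projective_hole (card G) (affine_embed ` P) (proj_hull A)"
    and "{z \<in> P. affine_embed z \<in> proj_hull A} = G"
proof -
  have "A \<noteq> {}" using G by auto
  have sub: "affine_embed ` G \<subseteq> proj_hull A" unfolding G(4)[symmetric] by (auto simp: proj_hull_def hull_inc)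
  have not_int: "p \<notin> interior (proj_hull A)" if p: "p \<in> affine_embed ` G" for p
  proof -
    obtain a where a: "a \<in> A" "p = rp2_of a" using p G(4) by (metis imageE)
    then have "a \<noteq> 0" using f(2)[OF a(1)] linear_0[OF f(1)] by auto
    moreover obtain g w where "linear g" "\<forall>b\<in>A. 0 \<le> (g b :: real)" "g w > 0" "g a = 0"
      using g[OF a(1)] by blast
    ultimately show ?thesis using not_in_interior_proj_hull[OF f, where g=g and w=w and x=a] a by simp
  qed
  show "{z \<in> P. affine_embed z \<in> proj_hull A} = G" using sub empty G by auto
  have card: "card (affine_embed ` G) = card G" by (intro card_image) (simp add: inj_on_def)
  have hull: "projective_convex_hull (affine_embed ` G) (proj_hull A)"
    using projective_convex_hull_proj_hull[OF f \<open>A \<noteq> {}\<close>] G by simp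
  have fr: "affine_embed ` G \<subseteq> frontier (proj_hull A)"
    using not_int sub closure_subset by (fastforce simp: frontier_def)
  have "projective_gon (card G) (affine_embed ` P) (proj_hull A)"
    unfolding projective_gon_def using hull fr G card by (intro exI[of _ "affine_embed ` G"]) auto
  moreover have "interior (proj_hull A) \<inter> affine_embed ` P = {}"
    using not_int empty interior_subset by fastforce
  ultimately show "projective_hole (card G) (affine_embed ` P) (proj_hull A)"
    unfolding projective_hole_def by blast
qed

section \<open>General position and charts for an infinite segment\<close>

text \<open>The determinant of three vectors, expanded along the first one.\<close>

definition tri_det :: "(real^2) \<times> real \<Rightarrow> (real^2) \<times> real \<Rightarrow> (real^2) \<times> real \<Rightarrow> real" where
  "tri_det x y z =
     fst x $ 1 * (fst y $ 2 * snd z - snd y * fst z $ 2)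
     - fst x $ 2 * (fst y $ 1 * snd z - snd y * fst z $ 1)
     + snd x * (fst y $ 1 * fst z $ 2 - fst y $ 2 * fst z $ 1)"

lemma tri_det_cramer:
  "tri_det u v e *\<^sub>R x = tri_det x v e *\<^sub>R u + tri_det u x e *\<^sub>R v + tri_det u v x *\<^sub>R e"
  by (rule prod_eqI) (simp_all add: tri_det_def vec_eq_iff forall_2 algebra_simps)

lemma linear_tri_det: "linear (\<lambda>x. tri_det x y z)" "linear (\<lambda>x. tri_det y x z)" "linear (\<lambda>x. tri_det y z x)"
  by (simp_all add: linear_iff tri_det_def algebra_simps)

lemma tri_det_repeat [simp]: "tri_det x x y = 0" "tri_det x y x = 0" "tri_det y x x = 0"
  by (simp_all add: tri_det_def algebra_simps)

lemma collinear_if_tri_det_zero: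
  assumes "tri_det (hom x) (hom y) (hom z) = 0"
  shows "collinear {x, y, z}"
proof (cases "x = y")
  case False
  define d where "d = x - y"
  define w where "w = z - y"
  have det: "d $ 1 * w $ 2 = d $ 2 * w $ 1"
    using assms by (simp add: tri_det_def hom_def d_def w_def algebra_simps)
  have "d $ 1 \<noteq> 0 \<or> d $ 2 \<noteq> 0" using False by (auto simp: d_def vec_eq_iff forall_2)
  then have "\<exists>k. w = k *\<^sub>R d"
  proof
    assume "d $ 1 \<noteq> 0"
    then have "w = (w $ 1 / d $ 1) *\<^sub>R d" using det by (simp add: vec_eq_iff forall_2 field_simps)
    then show ?thesis by blast
  next
    assume "d $ 2 \<noteq> 0"
    then have "w = (w $ 2 / d $ 2) *\<^sub>R d" using det by (simp add: vec_eq_iff forall_2 field_simps)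
    then show ?thesis by blast
  qed
  then have "collinear {0, x - y, z - y}"
    unfolding d_def w_def by (subst collinear_lemma) blast
  then show ?thesis by (simp add: collinear_3[of x y z])
qed simp

text \<open>The coordinates with respect to u, v, e, by Cramer's rule: c vanishes on the plane of u
  and v, where a and b are the coordinates.\<close>

lemma cone_chart_exists:
  assumes "tri_det u v e \<noteq> 0"
  obtains a b c :: "(real^2) \<times> real \<Rightarrow> real" where
    "linear a" "linear b" "linear c" "a u = 1" "b u = 0" "c u = 0" "a v = 0" "b v = 1" "c v = 0"
    "\<And>x. c x = 0 \<Longrightarrow> x = a x *\<^sub>R u + b x *\<^sub>R v"
proof -
  let ?d = "tri_det u v e"
  let ?a = "\<lambda>x. tri_det x v e / ?d" and ?b = "\<lambda>x. tri_det u x e / ?d" and ?c = "\<lambda>x. tri_det u v x / ?d"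
  have lin: "linear ?a" "linear ?b" "linear ?c"
    using linear_tri_det by (simp_all add: linear_iff add_divide_distrib)
  have "x = ?a x *\<^sub>R u + ?b x *\<^sub>R v" if "?c x = 0" for x
  proof -
    have "x = (1 / ?d) *\<^sub>R (?d *\<^sub>R x)" using assms by simp
    also have "\<dots> = ?a x *\<^sub>R u + ?b x *\<^sub>R v"
      unfolding tri_det_cramer[of u v e x] using that assms by (simp add: scaleR_add_right)
    finally show ?thesis .
  qed
  then show ?thesis using lin assms by (intro that[of ?a ?b ?c]) simp_all
qed

text \<open>The preimage of the image of an open cone is the union of the cone and its negative.\<close>

lemma open_rp2_of_image:
  assumes "open S" "0 \<notin> S" and cone: "\<And>x k. x \<in> S \<Longrightarrow> k > 0 \<Longrightarrow> k *\<^sub>R x \<in> S"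
  shows "open (rp2_of ` S)"
proof -
  have "{v. v \<noteq> 0 \<and> rp2_of v \<in> rp2_of ` S} = S \<union> uminus ` S"
  proof (intro equalityI subsetI)
    fix v assume "v \<in> {v. v \<noteq> 0 \<and> rp2_of v \<in> rp2_of ` S}"
    then obtain x where x: "v \<noteq> 0" "x \<in> S" "rp2_of x = rp2_of v" by force
    then have "x \<noteq> 0" using assms(2) by auto
    then obtain k where k: "k \<noteq> 0" "v = k *\<^sub>R x" using x rp2_of_eq_iff by auto
    show "v \<in> S \<union> uminus ` S"
    proof (cases "k > 0")
      case True
      then show ?thesis using cone x k by simp
    next
      case False
      then have "(- k) *\<^sub>R x \<in> S" using cone[OF x(2), of "- k"] k by simp
      then have "- v \<in> S" using k by simp
      then show ?thesis by (metis UnCI imageI minus_minus)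
    qed
  next
    fix v assume "v \<in> S \<union> uminus ` S"
    then have v: "v \<in> S \<or> - v \<in> S" by (metis UnE imageE minus_minus)
    then have "v \<noteq> 0" using assms(2) by auto
    have "rp2_of (- v) = rp2_of v" using rp2_of_scale[of v "-1"] \<open>v \<noteq> 0\<close> by simp
    then have "rp2_of v \<in> rp2_of ` S" using v imageI[of v S rp2_of] imageI[of "- v" S rp2_of] by auto
    with \<open>v \<noteq> 0\<close> show "v \<in> {v. v \<noteq> 0 \<and> rp2_of v \<in> rp2_of ` S}" by simp
  qed
  then show ?thesis using assms(1) by (simp add: open_rp2_def open_Un open_negations)
qed

lemma cone_in_proj_hull:
  assumes "x = k *\<^sub>R u + l *\<^sub>R v + m *\<^sub>R w" "x \<noteq> 0" "u \<in> A" "v \<in> A" "w \<in> A"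
    and "0 \<le> k" "0 \<le> l" "0 \<le> m"
  shows "rp2_of x \<in> proj_hull A"
proof -
  define \<sigma> where "\<sigma> = k + l + m"
  have "\<sigma> > 0" using assms by (cases "k + l + m = 0") (auto simp: \<sigma>_def add_nonneg_eq_0_iff)
  have "(1 / \<sigma>) *\<^sub>R x \<in> convex hull {u, v, w}"
    unfolding convex_hull_3 using assms \<open>\<sigma> > 0\<close>
    by (intro CollectI exI[of _ "k / \<sigma>"] exI[of _ "l / \<sigma>"] exI[of _ "m / \<sigma>"])
      (auto simp: scaleR_add_right \<sigma>_def simp flip: add_divide_distrib)
  also have "\<dots> \<subseteq> convex hull A" using assms by (intro hull_mono) simp
  finally have "rp2_of ((1 / \<sigma>) *\<^sub>R x) \<in> proj_hull A" by (simp add: proj_hull_def)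
  then show ?thesis using rp2_of_scale[of x "1 / \<sigma>"] assms(2) \<open>\<sigma> > 0\<close> by simp
qed

locale point_set =
  fixes P :: "(real^2) set"
  assumes finite_P: "finite P" and general: "general_position P"
begin

lemma tri_det_nonzero:
  assumes "x \<in> P" "y \<in> P" "z \<in> P" "x \<noteq> y" "x \<noteq> z" "y \<noteq> z"
  shows "tri_det (hom x) (hom y) (hom z) \<noteq> 0"
  using collinear_if_tri_det_zero[of x y z] general assms
  unfolding general_position_def by (force dest: spec[of _ "{x, y, z}"])

lemma hom_independent:
  assumes "x \<in> P" "y \<in> P" "z \<in> P" "x \<noteq> y" "x \<noteq> z" "y \<noteq> z"
    and "\<alpha> *\<^sub>R hom x + \<beta> *\<^sub>R hom y + \<gamma> *\<^sub>R hom z = 0"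
  shows "\<alpha> = 0"
proof -
  have "tri_det (\<alpha> *\<^sub>R hom x + \<beta> *\<^sub>R hom y + \<gamma> *\<^sub>R hom z) (hom y) (hom z) = 0"
    unfolding assms(7) using linear_0[OF linear_tri_det(1)] .
  then have "\<alpha> * tri_det (hom x) (hom y) (hom z) = 0"
    by (simp add: linear_add[OF linear_tri_det(1)] linear_scale[OF linear_tri_det(1)])
  then show ?thesis using tri_det_nonzero[OF assms(1-6)] by simp
qed

end

text \<open>The functionals a, b, c are coordinates for which the segment between p and q through infinity
  is the part of the plane c = 0 on which a and b are nonnegative. The minus sign at q is what makes
  the segment pass through infinity.\<close>

locale infinite_edge = point_set +
  fixes p q :: "real^2" and a b c :: "(real^2) \<times> real \<Rightarrow> real"
  assumes pq: "p \<in> P" "q \<in> P" "p \<noteq> q"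
    and linear: "linear a" "linear b" "linear c"
    and at_p: "a (hom p) = 1" "b (hom p) = 0" "c (hom p) = 0"
    and at_q: "a (- hom q) = 0" "b (- hom q) = 1" "c (- hom q) = 0"
    and kernel: "\<And>x. c x = 0 \<Longrightarrow> x = a x *\<^sub>R hom p + b x *\<^sub>R (- hom q)"
begin

lemmas add = linear[THEN linear_add]
lemmas scale = linear[THEN linear_scale]
lemmas diff = linear[THEN linear_diff]

text \<open>Scaling each remaining point to c = 1 turns it into the planar point (A z, B z), irrespective of
  the side on which it lies. Translations of that plane are the multiples of p and - q, so that the
  cone over p, - q and z is the quadrant above (A z, B z).\<close>

definition N :: "real^2 \<Rightarrow> (real^2) \<times> real" where
  "N z = (1 / c (hom z)) *\<^sub>R hom z"

definition A :: "real^2 \<Rightarrow> real" where "A z = a (N z)"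
definition B :: "real^2 \<Rightarrow> real" where "B z = b (N z)"

abbreviation "Q \<equiv> P - {p, q}"

text \<open>The functionals of the edges at t: \<open>\<alpha> t\<close> vanishes on the line through q and t, and
  \<open>\<beta> t\<close> on the line through p and t. At \<open>N z\<close> they compare z with t
  in the two coordinates.\<close>

definition \<alpha> :: "real^2 \<Rightarrow> (real^2) \<times> real \<Rightarrow> real" where "\<alpha> t x = a x - A t * c x"
definition \<beta> :: "real^2 \<Rightarrow> (real^2) \<times> real \<Rightarrow> real" where "\<beta> t x = b x - B t * c x"

lemma c_nonzero:
  assumes "z \<in> Q" shows "c (hom z) \<noteq> 0"
proof
  assume "c (hom z) = 0"
  then have "hom z - (a (hom z) *\<^sub>R hom p + b (hom z) *\<^sub>R (- hom q)) = 0"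
    unfolding right_minus_eq by (rule kernel)
  then have "1 *\<^sub>R hom z + (- a (hom z)) *\<^sub>R hom p + b (hom z) *\<^sub>R hom q = 0"
    by (simp add: algebra_simps)
  from hom_independent[OF _ _ _ _ _ _ this] have "(1::real) = 0" using assms pq by auto
  then show False by simp
qed

lemma hom_eq: "z \<in> Q \<Longrightarrow> hom z = c (hom z) *\<^sub>R N z"
  using c_nonzero by (simp add: N_def)

lemma c_N: "z \<in> Q \<Longrightarrow> c (N z) = 1"
  using c_nonzero by (simp add: N_def scale)

lemma rp2_of_N: "z \<in> Q \<Longrightarrow> rp2_of (N z) = affine_embed z" "z \<in> Q \<Longrightarrow> rp2_of (- N z) = affine_embed z"
  using rp2_of_scale[of "hom z" "1 / c (hom z)"] rp2_of_scale[of "hom z" "- 1 / c (hom z)"] c_nonzero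
  by (simp_all add: N_def affine_embed_eq)

lemma rp2_of_ends: "rp2_of (hom p) = affine_embed p" "rp2_of (- hom q) = affine_embed q"
  using rp2_of_scale[of "hom q" "- 1"] by (simp_all add: affine_embed_eq)

lemma linear_edge: "linear (\<alpha> t)" "linear (\<beta> t)"
  by (simp_all add: linear_iff \<alpha>_def \<beta>_def add scale algebra_simps)

lemma edge_at_p: "\<alpha> t (hom p) = 1" "\<beta> t (hom p) = 0"
  by (simp_all add: \<alpha>_def \<beta>_def at_p)

lemma edge_at_q: "\<alpha> t (- hom q) = 0" "\<beta> t (- hom q) = 1"
  by (simp_all only: \<alpha>_def \<beta>_def at_q)

lemma edge_at_N: "z \<in> Q \<Longrightarrow> \<alpha> t (N z) = A z - A t" "z \<in> Q \<Longrightarrow> \<beta> t (N z) = B z - B t"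
  by (simp_all add: \<alpha>_def \<beta>_def c_N A_def B_def)

text \<open>Two points with the same coordinate A would be collinear with q.\<close>

lemma inj_A: "inj_on A Q"
proof (rule inj_onI, rule ccontr)
  fix z y assume zy: "z \<in> Q" "y \<in> Q" "A z = A y" "z \<noteq> y"
  let ?w = "N z - N y"
  have "c ?w = 0" "a ?w = 0" using zy by (simp_all add: diff c_N A_def)
  then have "?w - b ?w *\<^sub>R (- hom q) = 0" using kernel[of ?w] by simp
  then have "(1 / c (hom z)) *\<^sub>R hom z + (- 1 / c (hom y)) *\<^sub>R hom y + b ?w *\<^sub>R hom q = 0"
    by (simp add: N_def)
  from hom_independent[OF _ _ _ _ _ _ this] have "1 / c (hom z) = 0" using zy pq by auto
  then show False using c_nonzero[OF zy(1)] by simp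
qed

section \<open>Holes at an infinite segment\<close>

definition triangle :: "real^2 \<Rightarrow> ((real^2) \<times> real) set" where
  "triangle r = {hom p, - hom q, N r}"

definition quadrilateral :: "real^2 \<Rightarrow> real^2 \<Rightarrow> ((real^2) \<times> real) set" where
  "quadrilateral r s = {hom p, - hom q, N r, - N s}"

text \<open>All three functionals are nonnegative on the hull. If it contains a multiple of \<open>N z\<close>, then
  the factor is positive because c is 1 at \<open>N z\<close>, and so z dominates r.\<close>

lemma triangle_hole:
  assumes r: "r \<in> Q" and max: "\<And>z. z \<in> Q \<Longrightarrow> A r \<le> A z \<Longrightarrow> B r \<le> B z \<Longrightarrow> z = r"
  shows "projective_hole 3 (affine_embed ` P) (proj_hull (triangle r))"
    and "{z \<in> P. affine_embed z \<in> proj_hull (triangle r)} = {p, q, r}"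
    and "rp2_of (hom p - hom q) \<in> proj_hull (triangle r)"
proof -
  let ?f = "\<lambda>x. \<alpha> r x + \<beta> r x + c x"
  have f: "linear ?f" by (intro linear_compose_add linear_edge linear)
  have pos: "0 < ?f x" if "x \<in> triangle r" for x
    using that unfolding triangle_def
    by (auto simp: edge_at_p edge_at_q at_p at_q edge_at_N[OF r] c_N[OF r])
  have nonneg: "0 \<le> \<alpha> r x" "0 \<le> \<beta> r x" "0 \<le> c x" if "x \<in> triangle r" for x
    using that unfolding triangle_def
    by (auto simp: edge_at_p edge_at_q at_p at_q edge_at_N[OF r] c_N[OF r])
  have edge: "\<exists>g w. linear g \<and> (\<forall>b\<in>triangle r. 0 \<le> (g b :: real)) \<and> g w > 0 \<and> g x = 0"
    if "x \<in> triangle r" for x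
  proof -
    from that consider "x = hom p" | "x = - hom q" | "x = N r" by (auto simp: triangle_def)
    then show ?thesis
    proof cases
      case 1 then show ?thesis using nonneg edge_at_p edge_at_q
        by (intro exI[of _ "\<beta> r"] exI[of _ "- hom q"]) (simp add: linear_edge)
    next
      case 2 then show ?thesis using nonneg edge_at_p edge_at_q
        by (intro exI[of _ "\<alpha> r"] exI[of _ "hom p"]) (simp add: linear_edge)
    next
      case 3 then show ?thesis using nonneg edge_at_p edge_at_N[OF r]
        by (intro exI[of _ "\<alpha> r"] exI[of _ "hom p"]) (simp add: linear_edge)
    qed
  qed
  have empty: "z \<in> {p, q, r}" if z: "z \<in> P" "affine_embed z \<in> proj_hull (triangle r)" for z
  proof (rule ccontr)
    assume "z \<notin> {p, q, r}"
    then have zQ: "z \<in> Q" using z by simp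
    then have "rp2_of (N z) \<in> proj_hull (triangle r)" "N z \<noteq> 0"
      using z rp2_of_N c_N[OF zQ] linear_0[OF linear(3)] by auto
    then obtain k y where k: "k \<noteq> 0" "y \<in> convex hull triangle r" "N z = k *\<^sub>R y"
      using in_proj_hullD[OF f pos, where x="N z"] by blast
    have y: "0 \<le> \<alpha> r y" "0 \<le> \<beta> r y" "0 \<le> c y"
      using linear_ge_on_hull[OF _ _ k(2)] nonneg linear linear_edge by blast+
    have "k * c y = 1" using c_N[OF zQ] k by (simp add: scale)
    moreover have "k * c y \<le> 0" if "k < 0" using that y(3) by (simp add: mult_nonpos_nonneg)
    ultimately have "k \<ge> 0" by linarith
    then have "0 \<le> k * \<alpha> r y" "0 \<le> k * \<beta> r y" using y by simp_all
    then have "A r \<le> A z" "B r \<le> B z"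
      using edge_at_N[OF zQ, of r] unfolding k(3)
      by (simp_all add: linear_edge[THEN linear_scale])
    then show False using max[OF zQ] \<open>z \<notin> {p, q, r}\<close> by simp
  qed
  have im: "rp2_of ` triangle r = affine_embed ` {p, q, r}"
    by (simp add: triangle_def rp2_of_ends rp2_of_N[OF r])
  have card: "card {p, q, r} = 3" using r pq by auto
  show "projective_hole 3 (affine_embed ` P) (proj_hull (triangle r))"
    using projective_hole_proj_hull(1)[OF f pos _ _ _ im edge empty] r pq card by auto
  show "{z \<in> P. affine_embed z \<in> proj_hull (triangle r)} = {p, q, r}"
    using projective_hole_proj_hull(2)[OF f pos _ _ _ im edge empty] r pq by auto
  have "(1/2) *\<^sub>R hom p + (1/2) *\<^sub>R (- hom q) \<in> convex hull triangle r"
    by (intro convexD[OF convex_convex_hull] hull_inc) (simp_all add: triangle_def)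
  then have "rp2_of ((1/2) *\<^sub>R (hom p - hom q)) \<in> proj_hull (triangle r)"
    by (auto simp: proj_hull_def scaleR_diff_right)
  moreover have "hom p - hom q \<noteq> 0" using pq by simp
  ultimately show "rp2_of (hom p - hom q) \<in> proj_hull (triangle r)"
    using rp2_of_scale[of "hom p - hom q" "1/2"] by simp
qed

lemma edge_vanishes:
  assumes "t \<in> Q"
  shows "\<alpha> t (hom q - hom t) = 0" "\<beta> t (hom p - hom t) = 0"
proof -
  have "\<alpha> t (c (hom t) *\<^sub>R N t) = 0" "\<beta> t (c (hom t) *\<^sub>R N t) = 0"
    by (simp_all add: linear_edge[THEN linear_scale] edge_at_N[OF assms])
  then have "\<alpha> t (hom t) = 0" "\<beta> t (hom t) = 0" unfolding hom_eq[OF assms, symmetric] .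
  moreover have "\<alpha> t (hom q) = 0" using edge_at_q(1)[of t] linear_neg[OF linear_edge(1)] by simp
  ultimately show "\<alpha> t (hom q - hom t) = 0" "\<beta> t (hom p - hom t) = 0"
    by (simp_all add: linear_edge[THEN linear_diff] edge_at_p)
qed

text \<open>The vector of s carries a minus sign because r and s lie on different sides of the segment. For
  a multiple of \<open>N z\<close> in the hull, the sign of the factor tells whether z dominates r or
  is dominated by s. Of the six infinite midpoints between the vertices, the four on the lines of
  the sides have a supporting functional; this is how the diagonals can be read off the set itself.\<close>

lemma quadrilateral_hole:
  assumes r: "r \<in> Q" and max: "\<And>z. z \<in> Q \<Longrightarrow> A r \<le> A z \<Longrightarrow> B r \<le> B z \<Longrightarrow> z = r"
    and s: "s \<in> Q" and min: "\<And>z. z \<in> Q \<Longrightarrow> A z \<le> A s \<Longrightarrow> B z \<le> B s \<Longrightarrow> z = s"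
    and less: "A s < A r" "B s < B r"
  shows "projective_hole 4 (affine_embed ` P) (proj_hull (quadrilateral r s))"
    and "{z \<in> P. affine_embed z \<in> proj_hull (quadrilateral r s)} = {p, q, r, s}"
    and "rp2_of (hom p - hom q) \<in> interior (proj_hull (quadrilateral r s))"
    and "\<And>x y. x \<in> {p, q, r, s} \<Longrightarrow> y \<in> {p, q, r, s} \<Longrightarrow> x \<noteq> y \<Longrightarrow>
        rp2_of (hom x - hom y) \<in> interior (proj_hull (quadrilateral r s)) \<Longrightarrow>
        {x, y} \<in> {{p, q}, {r, s}}"
proof -
  let ?R = "quadrilateral r s"
  let ?f = "\<lambda>x. (\<alpha> r x + \<alpha> s x) + (\<beta> r x + \<beta> s x)"
  have f: "linear ?f" by (intro linear_compose_add linear_edge)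
  have at_s: "\<alpha> t (- N s) = A t - A s" "\<beta> t (- N s) = B t - B s" for t
    using edge_at_N[OF s, of t] linear_neg[OF linear_edge(1)[of t], of "N s"] linear_neg[OF linear_edge(2)[of t], of "N s"] by simp_all
  have pos: "0 < ?f x" if "x \<in> ?R" for x
    using that less unfolding quadrilateral_def
    by (auto simp: edge_at_p edge_at_q edge_at_N[OF r] at_s)
  have nonneg: "0 \<le> \<alpha> r x" "0 \<le> \<beta> r x" "0 \<le> \<alpha> s x" "0 \<le> \<beta> s x" if "x \<in> ?R" for x
    using that less unfolding quadrilateral_def
    by (auto simp: edge_at_p edge_at_q edge_at_N[OF r] at_s)
  have edge: "\<exists>g w. linear g \<and> (\<forall>b\<in>?R. 0 \<le> (g b :: real)) \<and> g w > 0 \<and> g x = 0"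
    if "x \<in> ?R" for x
  proof -
    from that consider "x = hom p" | "x = - hom q" | "x = N r" | "x = - N s" by (auto simp: quadrilateral_def)
    then show ?thesis
    proof cases
      case 1 then show ?thesis using nonneg edge_at_p edge_at_q
        by (intro exI[of _ "\<beta> r"] exI[of _ "- hom q"]) (simp add: linear_edge)
    next
      case 2 then show ?thesis using nonneg edge_at_p edge_at_q
        by (intro exI[of _ "\<alpha> r"] exI[of _ "hom p"]) (simp add: linear_edge)
    next
      case 3 then show ?thesis using nonneg edge_at_p edge_at_N[OF r]
        by (intro exI[of _ "\<alpha> r"] exI[of _ "hom p"]) (simp add: linear_edge)
    next
      case 4 then show ?thesis using nonneg edge_at_p at_s
        by (intro exI[of _ "\<alpha> s"] exI[of _ "hom p"]) (simp add: linear_edge)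
    qed
  qed
  have empty: "z \<in> {p, q, r, s}" if z: "z \<in> P" "affine_embed z \<in> proj_hull ?R" for z
  proof (rule ccontr)
    assume "z \<notin> {p, q, r, s}"
    then have zQ: "z \<in> Q" using z by simp
    then have "rp2_of (N z) \<in> proj_hull ?R" "N z \<noteq> 0"
      using z rp2_of_N c_N[OF zQ] linear_0[OF linear(3)] by auto
    then obtain k y where k: "k \<noteq> 0" "y \<in> convex hull ?R" "N z = k *\<^sub>R y"
      using in_proj_hullD[OF f pos, where x="N z"] by blast
    have y: "0 \<le> \<alpha> r y" "0 \<le> \<beta> r y" "0 \<le> \<alpha> s y" "0 \<le> \<beta> s y"
      using linear_ge_on_hull[OF _ _ k(2)] nonneg linear_edge by blast+
    have at_z: "A z - A t = k * \<alpha> t y" "B z - B t = k * \<beta> t y" for t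
      using edge_at_N[OF zQ, of t] unfolding k(3)
      by (simp_all add: linear_edge[THEN linear_scale])
    show False
    proof (cases "k > 0")
      case True
      then have "0 \<le> A z - A r" "0 \<le> B z - B r" unfolding at_z using y by simp_all
      then show False using max[OF zQ] \<open>z \<notin> {p, q, r, s}\<close> by simp
    next
      case False
      then have "A z - A s \<le> 0" "B z - B s \<le> 0" unfolding at_z using y k(1)
        by (simp_all add: mult_nonpos_nonneg)
      then show False using min[OF zQ] \<open>z \<notin> {p, q, r, s}\<close> by simp
    qed
  qed
  have im: "rp2_of ` ?R = affine_embed ` {p, q, r, s}"
    by (simp add: quadrilateral_def rp2_of_ends rp2_of_N[OF r] rp2_of_N[OF s])
  have "r \<noteq> s" using less by auto
  then have card: "card {p, q, r, s} = 4" using r s pq by auto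
  show "projective_hole 4 (affine_embed ` P) (proj_hull ?R)"
    using projective_hole_proj_hull(1)[OF f pos _ _ _ im edge empty] r s pq card by auto
  show "{z \<in> P. affine_embed z \<in> proj_hull ?R} = {p, q, r, s}"
    using projective_hole_proj_hull(2)[OF f pos _ _ _ im edge empty] r s pq by auto
  show "rp2_of (hom p - hom q) \<in> interior (proj_hull ?R)"
  proof (rule interiorI)
    \<comment> \<open>The open cone cut out by the four sides; c decides which half of the quadrilateral contains x.\<close>
    let ?O = "{x. 0 < \<alpha> r x} \<inter> {x. 0 < \<alpha> s x} \<inter> {x. 0 < \<beta> r x} \<inter> {x. 0 < \<beta> s x}"
    show "open (rp2_of ` ?O)"
    proof (rule open_rp2_of_image)
      show "open ?O"
        by (intro open_Int open_Collect_less continuous_on_const linear_continuous_on linear_conv_bounded_linear[THEN iffD1] linear_edge)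
      show "0 \<notin> ?O" by (simp add: linear_edge[THEN linear_0])
      show "k *\<^sub>R x \<in> ?O" if "x \<in> ?O" "k > 0" for x k
        using that by (simp add: linear_edge[THEN linear_scale])
    qed
    have "\<alpha> t (hom p + (- hom q)) = 1" "\<beta> t (hom p + (- hom q)) = 1" for t
      unfolding linear_edge[THEN linear_add] edge_at_p edge_at_q by simp_all
    then show "rp2_of (hom p - hom q) \<in> rp2_of ` ?O" by (intro imageI) simp
    show "rp2_of ` ?O \<subseteq> proj_hull ?R"
    proof
      fix X assume "X \<in> rp2_of ` ?O"
      then obtain x where x: "X = rp2_of x" "x \<in> ?O" by blast
      have "x \<noteq> 0" using x(2) by (auto simp: linear_edge[THEN linear_0])
      have decomp: "x = \<alpha> t x *\<^sub>R hom p + \<beta> t x *\<^sub>R (- hom q) + c x *\<^sub>R N t" if "t \<in> Q" for t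
      proof -
        let ?y = "x - c x *\<^sub>R N t"
        have "c ?y = 0" "a ?y = \<alpha> t x" "b ?y = \<beta> t x"
          using that by (simp_all add: diff scale c_N \<alpha>_def \<beta>_def A_def B_def)
        with kernel[of ?y] have "?y = \<alpha> t x *\<^sub>R hom p + \<beta> t x *\<^sub>R (- hom q)" by simp
        then show ?thesis unfolding diff_eq_eq .
      qed
      show "X \<in> proj_hull ?R"
      proof (cases "c x \<ge> 0")
        case True
        show ?thesis unfolding x(1)
          by (rule cone_in_proj_hull[OF decomp[OF r] \<open>x \<noteq> 0\<close>])
            (use x True in \<open>auto simp: quadrilateral_def\<close>)
      next
        case False
        have "x = \<alpha> s x *\<^sub>R hom p + \<beta> s x *\<^sub>R (- hom q) + (- c x) *\<^sub>R (- N s)"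
          using decomp[OF s] unfolding scaleR_minus_left scaleR_minus_right minus_minus .
        then show ?thesis unfolding x(1)
          by (rule cone_in_proj_hull[OF _ \<open>x \<noteq> 0\<close>])
            (use x False in \<open>auto simp: quadrilateral_def\<close>)
      qed
    qed
  qed
  have boundary: "rp2_of (hom p - hom t) \<notin> interior (proj_hull ?R)"
      "rp2_of (hom q - hom t) \<notin> interior (proj_hull ?R)" if "t \<in> {r, s}" for t
  proof -
    have t: "t \<in> Q" using that r s by auto
    have ne: "hom p - hom t \<noteq> 0" "hom q - hom t \<noteq> 0" using t by auto
    show "rp2_of (hom p - hom t) \<notin> interior (proj_hull ?R)"
      by (rule not_in_interior_proj_hull[OF f pos linear_edge(2)[of t], where w="- hom q"])
         (use that nonneg ne edge_at_q edge_vanishes[OF t] in auto)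
    show "rp2_of (hom q - hom t) \<notin> interior (proj_hull ?R)"
      by (rule not_in_interior_proj_hull[OF f pos linear_edge(1)[of t], where w="hom p"])
         (use that nonneg ne edge_at_p edge_vanishes[OF t] in auto)
  qed
  have sym: "rp2_of (hom x - hom y) = rp2_of (hom y - hom x)" if "x \<noteq> y" for x y
    using rp2_of_scale[of "hom x - hom y" "-1"] that by simp
  show "{x, y} \<in> {{p, q}, {r, s}}"
    if "x \<in> {p, q, r, s}" "y \<in> {p, q, r, s}" "x \<noteq> y"
      "rp2_of (hom x - hom y) \<in> interior (proj_hull ?R)" for x y
    using that boundary[of r] boundary[of s] sym[OF \<open>x \<noteq> y\<close>] by auto
qed

end

text \<open>Injectivity of A makes the order antisymmetric on Q, and then the point with the largest A above s
  is maximal.\<close>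

lemma exists_dominant:
  fixes A B :: "'a \<Rightarrow> real"
  assumes "finite Q" "inj_on A Q" "s \<in> Q"
  shows "\<exists>r\<in>Q. A s \<le> A r \<and> B s \<le> B r \<and> (\<forall>z\<in>Q. A r \<le> A z \<and> B r \<le> B z \<longrightarrow> z = r)"
proof -
  let ?U = "{z \<in> Q. A s \<le> A z \<and> B s \<le> B z}"
  have "finite (A ` ?U)" "A ` ?U \<noteq> {}" using assms by auto
  then obtain r where r: "r \<in> ?U" "Max (A ` ?U) = A r"
    using Max_in[of "A ` ?U"] by (metis (no_types, lifting) imageE)
  have "z = r" if z: "z \<in> Q" "A r \<le> A z" "B r \<le> B z" for z
  proof -
    have "z \<in> ?U" using z r(1) by auto
    then have "A z \<le> A r" using Max_ge[OF \<open>finite (A ` ?U)\<close>] r(2) by auto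
    then show ?thesis using z r(1) inj_onD[OF assms(2), of z r] by simp
  qed
  then show ?thesis using r(1) by (intro bexI[of _ r]) auto
qed

context infinite_edge
begin

lemma finite_Q: "finite Q"
  using finite_P by simp

lemma exists_triangle_hole:
  assumes "Q \<noteq> {}"
  obtains r where "r \<in> Q" "projective_hole 3 (affine_embed ` P) (proj_hull (triangle r))"
    "{z \<in> P. affine_embed z \<in> proj_hull (triangle r)} = {p, q, r}"
    "rp2_of (hom p - hom q) \<in> proj_hull (triangle r)"
proof -
  obtain s where s: "s \<in> Q" using assms by blast
  obtain r where r: "r \<in> Q" and "A s \<le> A r \<and> B s \<le> B r \<and> (\<forall>z\<in>Q. A r \<le> A z \<and> B r \<le> B z \<longrightarrow> z = r)"
    using exists_dominant[OF finite_Q inj_A s, of B] by (rule bexE)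
  then have max: "z = r" if "z \<in> Q" "A r \<le> A z" "B r \<le> B z" for z using that by simp
  show ?thesis
    by (rule that[OF r triangle_hole]) (fact r max)+
qed

text \<open>Moving r up and s down preserves strict dominance, hence the convexity of the quadrilateral, and
  it stops at extremal points.\<close>

lemma exists_quadrilateral_hole:
  assumes "r \<in> Q" "s \<in> Q" "A s < A r" "B s < B r"
  obtains r' s' X where "r' \<in> Q" "s' \<in> Q"
    "projective_hole 4 (affine_embed ` P) X" "{z \<in> P. affine_embed z \<in> X} = {p, q, r', s'}"
    "rp2_of (hom p - hom q) \<in> interior X"
    "\<And>x y. x \<in> {p, q, r', s'} \<Longrightarrow> y \<in> {p, q, r', s'} \<Longrightarrow> x \<noteq> y \<Longrightarrow>
        rp2_of (hom x - hom y) \<in> interior X \<Longrightarrow> {x, y} \<in> {{p, q}, {r', s'}}"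
proof -
  obtain r' where r': "r' \<in> Q"
    and up: "A r \<le> A r' \<and> B r \<le> B r' \<and> (\<forall>z\<in>Q. A r' \<le> A z \<and> B r' \<le> B z \<longrightarrow> z = r')"
    using exists_dominant[OF finite_Q inj_A assms(1), of B] by (rule bexE)
  have max: "z = r'" if "z \<in> Q" "A r' \<le> A z" "B r' \<le> B z" for z using up that by simp
  have "inj_on (\<lambda>z. - A z) Q" using inj_A unfolding inj_on_def neg_equal_iff_equal .
  from exists_dominant[OF finite_Q this assms(2), of "\<lambda>z. - B z"]
  obtain s' where s': "s' \<in> Q"
    and down: "A s' \<le> A s \<and> B s' \<le> B s \<and> (\<forall>z\<in>Q. A z \<le> A s' \<and> B z \<le> B s' \<longrightarrow> z = s')"
    unfolding neg_le_iff_le by (rule bexE)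
  have min: "z = s'" if "z \<in> Q" "A z \<le> A s'" "B z \<le> B s'" for z using down that by simp
  have less: "A s' < A r'" "B s' < B r'" using up down assms by auto
  note hole = quadrilateral_hole[OF r' max s' min less]
  show ?thesis
    by (rule that[OF r' s' hole]) assumption+
qed

text \<open>Applying c to the relation shows that the right-hand side is a multiple of \<open>N r - N s\<close>;
  its coordinates k and l are positive, so the two differences have the same sign.\<close>

lemma dominance_of_crossing:
  assumes rs: "r \<in> Q" "s \<in> Q" and "k > 0" "l > 0"
    and eq: "k *\<^sub>R hom p - l *\<^sub>R hom q = m *\<^sub>R hom r + n *\<^sub>R hom s"
  shows "A s < A r \<and> B s < B r \<or> A r < A s \<and> B r < B s"
proof -
  let ?m = "m * c (hom r)" and ?n = "n * c (hom s)"
  have "k *\<^sub>R hom p + l *\<^sub>R (- hom q) = k *\<^sub>R hom p - l *\<^sub>R hom q" by simp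
  also have "\<dots> = ?m *\<^sub>R N r + ?n *\<^sub>R N s"
    unfolding eq using hom_eq[OF rs(1)] hom_eq[OF rs(2)] by (metis scaleR_scaleR)
  finally have *: "g (k *\<^sub>R hom p + l *\<^sub>R (- hom q)) = g (?m *\<^sub>R N r + ?n *\<^sub>R N s)"
    for g :: "(real^2) \<times> real \<Rightarrow> real" by simp
  have "?n = - ?m" using *[of c] rs unfolding add scale at_p at_q by (simp add: c_N)
  moreover have "k = ?m * A r + ?n * A s" using *[of a] unfolding add scale at_p at_q A_def by simp
  moreover have "l = ?m * B r + ?n * B s" using *[of b] unfolding add scale at_p at_q B_def by simp
  ultimately have "0 < ?m * (A r - A s)" "0 < ?m * (B r - B s)"
    using assms(3,4) by (simp_all add: right_diff_distrib)
  then show ?thesis by (cases "0 < ?m") (simp_all add: zero_less_mult_iff[of ?m])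
qed

end

context point_set
begin

text \<open>Some point of the infinite segment between p and q, away from the ends, lies on the line through
  two other points of P. The signs of m and n distinguish the finite from the infinite segment between
  r and s; both are admitted.\<close>

definition crossed :: "real^2 \<Rightarrow> real^2 \<Rightarrow> bool" where
  "crossed p q \<longleftrightarrow> (\<exists>r\<in>P - {p, q}. \<exists>s\<in>P - {p, q}. \<exists>k l m n. r \<noteq> s \<and> k > 0 \<and> l > 0 \<and>
     k *\<^sub>R hom p - l *\<^sub>R hom q = m *\<^sub>R hom r + n *\<^sub>R hom s)"

lemma infinite_edge_exists:
  assumes "p \<in> P" "q \<in> P" "p \<noteq> q" "e \<in> P - {p, q}"
  obtains a b c where "infinite_edge P p q a b c"
proof -
  have "tri_det (hom p) (- hom q) (hom e) = - tri_det (hom p) (hom q) (hom e)"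
    by (simp add: tri_det_def algebra_simps)
  then have "tri_det (hom p) (- hom q) (hom e) \<noteq> 0"
    using tri_det_nonzero[of p q e] assms by auto
  then show ?thesis
  proof (rule cone_chart_exists)
    fix a b c :: "(real^2) \<times> real \<Rightarrow> real"
    assume chart: "linear a" "linear b" "linear c" "a (hom p) = 1" "b (hom p) = 0" "c (hom p) = 0"
      "a (- hom q) = 0" "b (- hom q) = 1" "c (- hom q) = 0"
      "\<And>x. c x = 0 \<Longrightarrow> x = a x *\<^sub>R hom p + b x *\<^sub>R (- hom q)"
    have "infinite_edge P p q a b c"
      by (intro infinite_edge.intro point_set_axioms infinite_edge_axioms.intro) (fact assms chart)+
    then show ?thesis by (rule that)
  qed
qed

lemma exists_infinite_triangle:
  assumes "p \<in> P" "q \<in> P" "p \<noteq> q" "card P \<noteq> 2"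
  shows "\<exists>X. projective_hole 3 (affine_embed ` P) X \<and> \<not> X \<subseteq> range affine_embed \<and>
    {p, q} \<subseteq> {z \<in> P. affine_embed z \<in> X} \<and> card {z \<in> P. affine_embed z \<in> X} = 3"
proof -
  have "P \<noteq> {p, q}" using assms by auto
  then obtain e where "e \<in> P - {p, q}" using assms by blast
  from infinite_edge_exists[OF assms(1-3) this] obtain a b c where "infinite_edge P p q a b c" .
  then interpret infinite_edge P p q a b c .
  obtain r where "r \<in> Q" "projective_hole 3 (affine_embed ` P) (proj_hull (triangle r))"
    "{z \<in> P. affine_embed z \<in> proj_hull (triangle r)} = {p, q, r}"
    "rp2_of (hom p - hom q) \<in> proj_hull (triangle r)"
    using exists_triangle_hole \<open>e \<in> P - {p, q}\<close> by blast
  moreover have "card {p, q, r} = 3" using \<open>r \<in> Q\<close> assms by auto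
  ultimately show ?thesis using ideal_point_not_affine[OF assms(3)]
    by (intro exI[of _ "proj_hull (triangle r)"]) auto
qed

text \<open>For a quadrilateral hole, these are the vertex pairs whose infinite segment is a diagonal. The
  definition refers to X as a set only, because the pairs are counted per set.\<close>

definition ideal_diagonals :: "rp2 set \<Rightarrow> (real^2) set set" where
  "ideal_diagonals X = {{x, y} | x y. x \<in> P \<and> y \<in> P \<and> x \<noteq> y \<and> affine_embed x \<in> X \<and>
     affine_embed y \<in> X \<and> rp2_of (hom x - hom y) \<in> interior X}"

lemma exists_infinite_quadrilateral:
  assumes "p \<in> P" "q \<in> P" "p \<noteq> q" "crossed p q"
  shows "\<exists>X. projective_hole 4 (affine_embed ` P) X \<and> \<not> X \<subseteq> range affine_embed \<and>
    {p, q} \<in> ideal_diagonals X \<and> card (ideal_diagonals X) \<le> 2"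
proof -
  obtain r s k l m n where c: "r \<in> P - {p, q}" "s \<in> P - {p, q}" "k > 0" "l > 0"
     "k *\<^sub>R hom p - l *\<^sub>R hom q = m *\<^sub>R hom r + n *\<^sub>R hom s"
    using assms(4) unfolding crossed_def by blast
  from infinite_edge_exists[OF assms(1-3) c(1)] obtain a b c where "infinite_edge P p q a b c" .
  then interpret infinite_edge P p q a b c .
  obtain r0 s0 where "r0 \<in> Q" "s0 \<in> Q" "A s0 < A r0" "B s0 < B r0"
    using dominance_of_crossing[OF c] c(1,2) by blast
  then obtain r' s' X where X: "r' \<in> Q" "s' \<in> Q"
    "projective_hole 4 (affine_embed ` P) X" "{z \<in> P. affine_embed z \<in> X} = {p, q, r', s'}"
    "rp2_of (hom p - hom q) \<in> interior X"
    "\<And>x y. x \<in> {p, q, r', s'} \<Longrightarrow> y \<in> {p, q, r', s'} \<Longrightarrow> x \<noteq> y \<Longrightarrow>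
        rp2_of (hom x - hom y) \<in> interior X \<Longrightarrow> {x, y} \<in> {{p, q}, {r', s'}}"
    by (rule exists_quadrilateral_hole) blast
  have "ideal_diagonals X \<subseteq> {{p, q}, {r', s'}}"
  proof
    fix e assume "e \<in> ideal_diagonals X"
    then obtain x y where xy: "e = {x, y}" "x \<in> {z \<in> P. affine_embed z \<in> X}"
      "y \<in> {z \<in> P. affine_embed z \<in> X}" "x \<noteq> y" "rp2_of (hom x - hom y) \<in> interior X"
      unfolding ideal_diagonals_def by blast
    then show "e \<in> {{p, q}, {r', s'}}" unfolding xy(1) X(4) by (intro X(6))
  qed
  then have "card (ideal_diagonals X) \<le> card {{p, q}, {r', s'}}" by (intro card_mono) auto
  also have "\<dots> \<le> 2" by (simp add: card_insert_if)
  finally have "card (ideal_diagonals X) \<le> 2" .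
  moreover have "p \<in> {z \<in> P. affine_embed z \<in> X}" "q \<in> {z \<in> P. affine_embed z \<in> X}"
    unfolding X(4) by auto
  then have "{p, q} \<in> ideal_diagonals X" using X(5) assms unfolding ideal_diagonals_def by blast
  moreover have "\<not> X \<subseteq> range affine_embed"
    using ideal_point_not_affine[OF assms(3)] X(5) interior_subset by blast
  ultimately show ?thesis using X(3) by blast
qed

lemma crossed_if_positive_coordinate:
  assumes "r \<in> P - {p, q}" "s \<in> P - {p, q}" "r \<noteq> s" "k > 0"
    and "hom p = k *\<^sub>R hom q + m *\<^sub>R hom r + n *\<^sub>R hom s"
  shows "crossed p q"
proof -
  have "1 *\<^sub>R hom p - k *\<^sub>R hom q = m *\<^sub>R hom r + n *\<^sub>R hom s" using assms(5) by simp
  then show ?thesis unfolding crossed_def using assms zero_less_one by blast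
qed

text \<open>Three partners form a triangle, and the barycentric coordinates of p in it have sum 1, so one of
  them is positive.\<close>

lemma card_uncrossed:
  assumes "p \<in> P"
  shows "card {q \<in> P - {p}. \<not> crossed p q} \<le> 2"
proof (rule ccontr)
  assume "\<not> card {q \<in> P - {p}. \<not> crossed p q} \<le> 2"
  then have "3 \<le> card {q \<in> P - {p}. \<not> crossed p q}" by simp
  then obtain T where "T \<subseteq> {q \<in> P - {p}. \<not> crossed p q}" "card T = 3"
    by (rule obtain_subset_with_card_n)
  then obtain u v w where
    uvw: "u \<noteq> v" "v \<noteq> w" "u \<noteq> w" "u \<in> P - {p}" "v \<in> P - {p}" "w \<in> P - {p}"
    and unc: "\<not> crossed p u" "\<not> crossed p v" "\<not> crossed p w"
    by (auto simp: card_3_iff)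
  let ?d = "tri_det (hom u) (hom v) (hom w)"
  define k where "k = tri_det (hom p) (hom v) (hom w) / ?d"
  define l where "l = tri_det (hom u) (hom p) (hom w) / ?d"
  define m where "m = tri_det (hom u) (hom v) (hom p) / ?d"
  have "?d \<noteq> 0" using uvw by (intro tri_det_nonzero) auto
  then have "hom p = (1 / ?d) *\<^sub>R (?d *\<^sub>R hom p)" by simp
  also have "\<dots> = k *\<^sub>R hom u + l *\<^sub>R hom v + m *\<^sub>R hom w"
    unfolding tri_det_cramer[of _ _ _ "hom p"] by (simp add: scaleR_add_right k_def l_def m_def)
  finally have eq: "hom p = k *\<^sub>R hom u + l *\<^sub>R hom v + m *\<^sub>R hom w" .
  then have "snd (hom p) = snd (k *\<^sub>R hom u + l *\<^sub>R hom v + m *\<^sub>R hom w)" by (rule arg_cong)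
  then have "k + l + m = 1" by (simp add: hom_def)
  then consider "k > 0" | "l > 0" | "m > 0" by linarith
  then show False
  proof cases
    case 1
    have "crossed p u" by (rule crossed_if_positive_coordinate[OF _ _ _ 1 eq]) (use uvw in auto)
    then show False using unc by simp
  next
    case 2
    have eq': "hom p = l *\<^sub>R hom v + k *\<^sub>R hom u + m *\<^sub>R hom w" using eq by (simp add: add.commute)
    have "crossed p v" by (rule crossed_if_positive_coordinate[OF _ _ _ 2 eq']) (use uvw in auto)
    then show False using unc by simp
  next
    case 3
    have eq': "hom p = m *\<^sub>R hom w + k *\<^sub>R hom u + l *\<^sub>R hom v" using eq by (simp add: add.commute)
    have "crossed p w" by (rule crossed_if_positive_coordinate[OF _ _ _ 3 eq']) (use uvw in auto)
    then show False using unc by simp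
  qed
qed

end

section \<open>Affine holes as projective holes\<close>

lemma continuous_affine_embed: "open U \<Longrightarrow> open (affine_embed -` U)"
proof -
  assume "open U"
  then have "open (hom -` {v. v \<noteq> 0 \<and> rp2_of v \<in> U})"
    by (intro open_vimage open_preimage) (auto simp: hom_def [abs_def] intro!: continuous_intros)
  moreover have "hom -` {v. v \<noteq> 0 \<and> rp2_of v \<in> U} = affine_embed -` U"
    by (auto simp: affine_embed_eq)
  ultimately show ?thesis by simp
qed

lemma interior_affine_image:
  assumes "affine_embed x \<in> interior (affine_embed ` X)"
  shows "x \<in> interior X"
proof (rule interiorI)
  show "open (affine_embed -` interior (affine_embed ` X))" by (intro continuous_affine_embed) simp
  show "affine_embed -` interior (affine_embed ` X) \<subseteq> X"
    using interior_subset by fastforce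
qed (use assms in simp)

lemma affine_image_convex_hull: "affine_embed ` (convex hull E) = proj_hull (hom ` E)"
proof -
  have hom: "hom ` S = S \<times> {1}" for S by (auto simp: hom_def)
  have "hom ` (convex hull E) = convex hull (hom ` E)"
    unfolding hom convex_hull_Times by simp
  from this[symmetric] show ?thesis by (simp add: proj_hull_def affine_embed_eq image_image)
qed

text \<open>The functional of the line at infinity is the last coordinate. Extreme points remain on the
  frontier because the embedding is continuous and injective: it reflects interior points.\<close>

lemma projective_hole_of_affine_hole:
  assumes "affine_hole k P X" "k > 0"
  shows "projective_hole k (affine_embed ` P) (affine_embed ` X)"
proof -
  let ?E = "vertices X"
  have X: "polytope X" "aff_dim X = 2" "card ?E = k" "?E \<subseteq> P" "interior X \<inter> P = {}"
    using assms(1) by (simp_all add: affine_hole_def convex_polygon_def)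
  have "finite ?E" "?E \<noteq> {}" using X(3) assms(2) card_gt_0_iff[of ?E] by simp_all
  have hull: "X = convex hull ?E"
    unfolding vertices_def using X(1)
    by (intro Krein_Milman_Minkowski) (auto simp: polytope_imp_compact polytope_imp_convex)
  have sub: "affine_embed ` ?E \<subseteq> affine_embed ` X" by (auto simp: vertices_def extreme_point_of_def)
  have bd: "affine_embed x \<notin> interior (affine_embed ` X)" if "x \<in> ?E" for x
  proof -
    have "x extreme_point_of X" using that by (simp add: vertices_def)
    then have "x \<notin> interior X" by (rule extreme_point_not_in_interior)
    then show ?thesis using interior_affine_image[of x X] by blast
  qed
  have "rp2_of ` hom ` ?E = affine_embed ` ?E" by (simp add: image_image affine_embed_eq)
  moreover have "projective_convex_hull (rp2_of ` hom ` ?E) (proj_hull (hom ` ?E))"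
    using \<open>?E \<noteq> {}\<close> by (intro projective_convex_hull_proj_hull[where f=snd]) (auto simp: hom_def linear_snd)
  ultimately have "projective_convex_hull (affine_embed ` ?E) (affine_embed ` X)"
    using affine_image_convex_hull[of ?E] hull by simp
  moreover have "card (affine_embed ` ?E) = k" using X(3) by (subst card_image) (auto simp: inj_on_def)
  moreover have "affine_embed ` ?E \<subseteq> frontier (affine_embed ` X)"
    using bd sub closure_subset by (fastforce simp: frontier_def)
  ultimately have "projective_gon k (affine_embed ` P) (affine_embed ` X)"
    unfolding projective_gon_def using X(4) \<open>finite ?E\<close> by (intro exI[of _ "affine_embed ` ?E"]) auto
  moreover have "interior (affine_embed ` X) \<inter> affine_embed ` P = {}"
    using interior_affine_image X(5) by blast
  ultimately show ?thesis unfolding projective_hole_def by blast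
qed

section \<open>Counting the holes at infinity\<close>

lemma card_le_fibres:
  assumes "finite F" "f ` E \<subseteq> F" "\<And>X. X \<in> f ` E \<Longrightarrow> card {e \<in> E. f e = X} \<le> m"
  shows "card E \<le> m * card F"
proof -
  have "E = (\<Union>X\<in>f ` E. {e \<in> E. f e = X})" by blast
  then have "card E \<le> (\<Sum>X\<in>f ` E. card {e \<in> E. f e = X})"
    using card_UN_le[of "f ` E" "\<lambda>X. {e \<in> E. f e = X}"] finite_subset[OF assms(2,1)] by simp
  also have "\<dots> \<le> (\<Sum>X\<in>f ` E. m)" using assms(3) by (rule sum_mono)
  also have "\<dots> = m * card (f ` E)" by simp
  also have "\<dots> \<le> m * card F" using card_mono[OF assms(1,2)] by simp
  finally show ?thesis .
qed

definition infinite_holes :: "nat \<Rightarrow> (real^2) set \<Rightarrow> rp2 set set" where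
  "infinite_holes k P = {X. projective_hole k (affine_embed ` P) X \<and> \<not> X \<subseteq> range affine_embed}"

lemma finite_infinite_holes: "finite P \<Longrightarrow> k > 0 \<Longrightarrow> finite (infinite_holes k P)"
  using finite_projective_holes[of P k] unfolding infinite_holes_def by (rule rev_finite_subset) auto

lemma num_projective_holes_ge:
  assumes "finite P" "k > 0"
  shows "num_affine_holes k P + card (infinite_holes k P) \<le> num_projective_holes k (affine_embed ` P)"
proof -
  let ?H = "{X. projective_hole k (affine_embed ` P) X}"
  let ?A = "(`) affine_embed ` {X. affine_hole k P X}"
  have fin: "finite ?H" using finite_projective_holes[OF assms] .
  have sub: "?A \<union> infinite_holes k P \<subseteq> ?H"
    using projective_hole_of_affine_hole assms(2) unfolding infinite_holes_def by blast
  have "inj affine_embed" by (simp add: inj_def)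
  then have "num_affine_holes k P = card ?A"
    unfolding num_affine_holes_def by (subst card_image) (auto simp: inj_on_def inj_image_eq_iff)
  moreover have "?A \<inter> infinite_holes k P = {}" unfolding infinite_holes_def by blast
  ultimately have "num_affine_holes k P + card (infinite_holes k P) = card (?A \<union> infinite_holes k P)"
    using card_Un_disjoint[of ?A "infinite_holes k P"] finite_subset[OF sub fin] by simp
  also have "\<dots> \<le> card ?H" using card_mono[OF fin sub] .
  finally show ?thesis unfolding num_projective_holes_def .
qed

context point_set
begin

definition pairs :: "(real^2) set set" where
  "pairs = {e. e \<subseteq> P \<and> card e = 2}"

lemma card_pairs: "card pairs = card P choose 2"
  unfolding pairs_def by (rule n_subsets[OF finite_P])

lemma infinite_triangles:
  assumes "card P \<noteq> 2"
  shows "card P choose 2 \<le> 3 * card (infinite_holes 3 P)"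
proof -
  let ?V = "\<lambda>X. {z \<in> P. affine_embed z \<in> X}"
  have ex: "\<exists>X. X \<in> infinite_holes 3 P \<and> e \<subseteq> ?V X \<and> card (?V X) = 3" if e: "e \<in> pairs" for e
  proof -
    obtain p q where "e = {p, q}" "p \<noteq> q" "p \<in> P" "q \<in> P"
      using e by (auto simp: pairs_def card_2_iff)
    then show ?thesis using exists_infinite_triangle[of p q] assms unfolding infinite_holes_def by auto
  qed
  define f where "f e = (SOME X. X \<in> infinite_holes 3 P \<and> e \<subseteq> ?V X \<and> card (?V X) = 3)" for e
  have f: "f e \<in> infinite_holes 3 P" "e \<subseteq> ?V (f e)" "card (?V (f e)) = 3" if "e \<in> pairs" for e
    using someI_ex[OF ex[OF that]] unfolding f_def by simp_all
  have "card pairs \<le> 3 * card (infinite_holes 3 P)"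
  proof (rule card_le_fibres)
    show "finite (infinite_holes 3 P)" using finite_infinite_holes[OF finite_P] by simp
    show "f ` pairs \<subseteq> infinite_holes 3 P" using f(1) by blast
    fix X assume "X \<in> f ` pairs"
    then have V: "card (?V X) = 3" using f(3) by blast
    have fin: "finite (?V X)" using finite_P by simp
    have "{e \<in> pairs. f e = X} \<subseteq> {e. e \<subseteq> ?V X \<and> card e = 2}"
      using f(2) by (auto simp: pairs_def)
    then have "card {e \<in> pairs. f e = X} \<le> card {e. e \<subseteq> ?V X \<and> card e = 2}"
      using fin by (intro card_mono) auto
    also have "\<dots> = 3" using n_subsets[OF fin, of 2] V by (simp add: numeral_eq_Suc)
    finally show "card {e \<in> pairs. f e = X} \<le> 3" .
  qed
  then show ?thesis by (simp add: card_pairs)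
qed

lemma infinite_quadrilaterals:
  "card P choose 2 \<le> 2 * card (infinite_holes 4 P) + 2 * card P"
proof -
  define E where "E = {{p, q} | p q. p \<in> P \<and> q \<in> P \<and> p \<noteq> q \<and> crossed p q}"
  define U where "U = (SIGMA p:P. {q \<in> P - {p}. \<not> crossed p q})"
  have finU: "finite U" unfolding U_def using finite_P by (intro finite_SigmaI) auto
  have "card U = (\<Sum>p\<in>P. card {q \<in> P - {p}. \<not> crossed p q})"
    unfolding U_def using finite_P by (intro card_SigmaI) auto
  also have "\<dots> \<le> (\<Sum>p\<in>P. 2)" by (rule sum_mono) (rule card_uncrossed)
  finally have "card U \<le> (\<Sum>p\<in>P. 2)" .
  then have U: "card U \<le> 2 * card P" by simp
  have "pairs \<subseteq> E \<union> (\<lambda>(p, q). {p, q}) ` U"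
  proof
    fix e assume "e \<in> pairs"
    then obtain p q where pq: "e = {p, q}" "p \<noteq> q" "p \<in> P" "q \<in> P"
      by (auto simp: pairs_def card_2_iff)
    show "e \<in> E \<union> (\<lambda>(p, q). {p, q}) ` U"
    proof (cases "crossed p q")
      case True then show ?thesis using pq unfolding E_def by blast
    next
      case False
      then have "(p, q) \<in> U" using pq by (simp add: U_def)
      then show ?thesis using pq(1) by force
    qed
  qed
  moreover have "E \<subseteq> Pow P" by (auto simp: E_def)
  then have finE: "finite E" using finite_P by (simp add: finite_subset)
  ultimately have "card pairs \<le> card (E \<union> (\<lambda>(p, q). {p, q}) ` U)"
    using finU by (intro card_mono) auto
  also have "\<dots> \<le> card E + card U"
    using card_Un_le[of E "(\<lambda>(p, q). {p, q}) ` U"] card_image_le[OF finU, of "\<lambda>(p, q). {p, q}"] by linarith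
  finally have "card pairs \<le> card E + 2 * card P" using U by linarith
  moreover have "card E \<le> 2 * card (infinite_holes 4 P)"
  proof -
    have ex: "\<exists>X. X \<in> infinite_holes 4 P \<and> e \<in> ideal_diagonals X \<and> card (ideal_diagonals X) \<le> 2"
      if "e \<in> E" for e
      using that exists_infinite_quadrilateral unfolding E_def infinite_holes_def by blast
    define f where "f e = (SOME X. X \<in> infinite_holes 4 P \<and> e \<in> ideal_diagonals X \<and> card (ideal_diagonals X) \<le> 2)" for e
    have f: "f e \<in> infinite_holes 4 P" "e \<in> ideal_diagonals (f e)" "card (ideal_diagonals (f e)) \<le> 2"
      if "e \<in> E" for e
      using someI_ex[OF ex[OF that]] unfolding f_def by simp_all
    show ?thesis
    proof (rule card_le_fibres)
      show "finite (infinite_holes 4 P)" using finite_infinite_holes[OF finite_P] by simp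
      show "f ` E \<subseteq> infinite_holes 4 P" using f(1) by blast
      fix X assume "X \<in> f ` E"
      then have X: "card (ideal_diagonals X) \<le> 2" using f(3) by blast
      have "ideal_diagonals X \<subseteq> Pow P" by (auto simp: ideal_diagonals_def)
      then have "finite (ideal_diagonals X)" using finite_P by (simp add: finite_subset)
      then have "card {e \<in> E. f e = X} \<le> card (ideal_diagonals X)"
        using f(2) by (intro card_mono) auto
      with X show "card {e \<in> E. f e = X} \<le> 2" by simp
    qed
  qed
  ultimately show ?thesis by (simp add: card_pairs)
qed

end

theorem proposition7:
  fixes P :: "(real^2) set" and n :: nat
  assumes "finite P" and "card P = n" and "general_position P"
  shows "(n \<noteq> 2 \<longrightarrow>
            real (num_projective_holes 3 (affine_embed ` P))
              \<ge> real (num_affine_holes 3 P) + 1 / 3 * real (n choose 2)) \<and>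
         (n \<noteq> 0 \<longrightarrow>
            real (num_projective_holes 4 (affine_embed ` P))
              \<ge> real (num_affine_holes 4 P) + 1 / 2 * (real (n choose 2) - 3 * real n + 3))"
proof -
  interpret point_set P using assms by unfold_locales
  have total: "real (num_affine_holes k P) + real (card (infinite_holes k P))
      \<le> real (num_projective_holes k (affine_embed ` P))" if "k > 0" for k
    using num_projective_holes_ge[OF assms(1) that] unfolding of_nat_add[symmetric] of_nat_le_iff .
  have three: "real (num_affine_holes 3 P) + 1 / 3 * real (n choose 2)
      \<le> real (num_projective_holes 3 (affine_embed ` P))" if "n \<noteq> 2"
  proof -
    have "real (n choose 2) \<le> real (3 * card (infinite_holes 3 P))"
      using infinite_triangles that assms(2) unfolding of_nat_le_iff by simp
    then show ?thesis using total[of 3] by simp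
  qed
  have ideal: "real (n choose 2) - 3 * real n + 3 \<le> 2 * real (card (infinite_holes 4 P))" if "n \<noteq> 0"
  proof (cases "n \<le> 2")
    case True
    with that consider "n = 1" | "n = 2" by linarith
    then show ?thesis by cases (simp_all add: binomial_eq_0)
  next
    case False
    have "real (n choose 2) \<le> real (2 * card (infinite_holes 4 P) + 2 * n)"
      using infinite_quadrilaterals assms(2) unfolding of_nat_le_iff by simp
    then show ?thesis using False by simp
  qed
  have four: "real (num_affine_holes 4 P) + 1 / 2 * (real (n choose 2) - 3 * real n + 3)
      \<le> real (num_projective_holes 4 (affine_embed ` P))" if "n \<noteq> 0"
  proof -
    have "x + 1 / 2 * d \<le> z" if "x + y \<le> z" "d \<le> 2 * y" for x y z d :: real
      using that by simp
    from this[OF total ideal[OF \<open>n \<noteq> 0\<close>]] show ?thesis by simp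
  qed
  show ?thesis using three four by blast
qed

end
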